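(* Let $\Gamma$ be a connected graph with vertex set $V$ and path-metric $d$. Assume there exists a function $h:V\to\mathbb{Z}$ with the following properties: (A) for any $x,y\in V$, $|h(x)-h(y)|\le d(x,y)$; (B) for each $b\in V$ there exists exactly one element $c\in V$ such that $d(b,c)=1$ and $h(c)=h(b)+1$; (C) for each $b\in V$ there exists at least one vertex $a\in V$ such that $d(a,b)=1$ and $h(a)=h(b)-1$. Then the following holds true. (1) Any finite subset $\Omega\subset V$ admits a one-by-one exhaustion. (2) If $\Gamma$ admits weights satisfying the Sunada-Sy condition and if $H=\Delta+q$ is a Schrödinger operator on the weighted graph $\Gamma$, defined by a bounded potential $q$, then $H$ satisfies $\lambda$-uniqueness, for any $\lambda\in\mathbb{R}$, on any subset $\Omega\subset V$ such that $\min_{\omega\in\Omega}h(\omega)>-\infty$ (that is, $h$ is bounded below on $\Omega$).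
   Context: Graph (Serre): $\Gamma=(V,E,o,t,\iota)$ with vertex set $V$, set $E$ of oriented edges, origin and terminus maps $o,t:E\to V$, and a fixed point free involution $\iota(e)=\overline{e}$ of $E$ with $o(\overline e)=t(e)$, $t(\overline e)=o(e)$. Loops and multiple edges are allowed; local finiteness is not assumed. $E_x=\{e\in E:o(e)=x\}$. $\Gamma$ is connected if any two vertices are joined by a finite edge path; the path-metric $d(x,y)$ is the minimal length of a path from $x$ to $y$. $B(x,r)=\{y\in V:d(x,y)\le r\}$. Weighted graph: strictly positive weights $m_V:V\to\,]0,\infty[$ and $m_E:E\to\,]0,\infty[$ with $m_E(\overline e)=m_E(e)$. $l^2(V,m_V)$ is the Hilbert space of $\varphi:V\to\mathbb{C}$ with $\sum_x|\varphi(x)|^2m_V(x)<\infty$, with product $\langle\varphi,\psi\rangle=\sum_x\varphi(x)\overline{\psi(x)}m_V(x)$. Sunada-Sy condition: $\sup_{x\in V}\frac{1}{m_V(x)}\sum_{e\in E_x}m_E(e)<\infty$. Laplacian: the bounded operator on $l^2(V,m_V)$ given by $\Delta\varphi(x)=\left(\frac{1}{m_V(x)}\sum_{e\in E_x}m_E(e)\right)\varphi(x)-\frac{1}{m_V(x)}\sum_{e\in E_x}\varphi(t(e))m_E(e)$. Schrödinger operator: $H=\Delta+q$ with potential $q:V\to\mathbb{R}$ bounded. $\lambda$-uniqueness on $\Omega\subset V$: if $\varphi\in l^2(V,m_V)$ satisfies $H\varphi=\lambda\varphi$ and $\varphi(x)=0$ for all $x\in V\setminus\Omega$, then $\varphi=0$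 on $V$. One-by-one exhaustion of $\Omega\subset V$: a countable (finite or infinite) non-decreasing sequence $V_0\subset\cdots\subset V_n\subset V_{n+1}\subset\cdots$ of subsets of $V$ such that (1) $V_0=V\setminus\Omega$; (2) for each $n$ (for which $V_{n+1}$ is a term of the sequence) there exists $x_n\in V_n$ with $V_{n+1}=V_n\cup B(x_n,1)$; (3) for each such $n$, either $|V_{n+1}\setminus V_n|=1$ or $V_n=V$; (4) $\bigcup_nV_n=V$. *)

theory Defs
  imports
    "HOL-Analysis.Elementary_Metric_Spaces"
    "HOL-Analysis.Infinite_Sum"
    "HOL-Library.Extended_Nat"
    "Graph_Theory.Bidirected_Digraph"
    "Graph_Theory.Arc_Walk"
begin

text \<open>
  A graph in the sense of Serre is a \<^locale>\<open>bidirected_digraph\<close>: the arcs are the oriented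
  edges, \<^const>\<open>tail\<close> and \<^const>\<open>head\<close> are the origin and terminus maps, and \<open>arev\<close> is the fixed
  point free involution (the locale makes it the identity outside the set of arcs).
  Loops, multiple edges and infinite degrees are allowed.
\<close>

text \<open>
  Unlike \<open>strongly_connected\<close> from Digraph_Component, this does not exclude the graph without vertices.
\<close>

definition graph_connected :: "('v, 'e) pre_digraph \<Rightarrow> bool" where
  "graph_connected G \<longleftrightarrow>
     (\<forall>x\<in>verts G. \<forall>y\<in>verts G. \<exists>p. pre_digraph.awalk G x p y)"

text \<open>Only meaningful for vertices joined by a walk, in particular for connected graphs.\<close>

definition path_dist :: "('v, 'e) pre_digraph \<Rightarrow> 'v \<Rightarrow> 'v \<Rightarrow> nat" where
  "path_dist G x y = (LEAST n. \<exists>p. pre_digraph.awalk G x p y \<and> length p = n)"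

definition graph_ball :: "('v, 'e) pre_digraph \<Rightarrow> 'v \<Rightarrow> nat \<Rightarrow> 'v set" where
  "graph_ball G x r = {y \<in> verts G. path_dist G x y \<le> r}"

locale weighted_graph = bidirected_digraph G arev
  for G :: "('v, 'e) pre_digraph" and arev :: "'e \<Rightarrow> 'e" +
  fixes mV :: "'v \<Rightarrow> real" and mE :: "'e \<Rightarrow> real"
  assumes mV_pos: "x \<in> verts G \<Longrightarrow> mV x > 0"
    and mE_pos: "e \<in> arcs G \<Longrightarrow> mE e > 0"
    and mE_arev: "e \<in> arcs G \<Longrightarrow> mE (arev e) = mE e"

definition l2_space :: "('v, 'e) pre_digraph \<Rightarrow> ('v \<Rightarrow> real) \<Rightarrow> ('v \<Rightarrow> complex) set" where
  "l2_space G mV = {\<phi>. (\<lambda>x. (cmod (\<phi> x))\<^sup>2 * mV x) summable_on verts G}"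

text \<open>
  As \<^const>\<open>infsum\<close> is \<open>0\<close> on families that are not summable, finiteness of the sum over the
  possibly infinite set of edges at each vertex has to be required separately.
\<close>

definition sunada_sy ::
    "('v, 'e) pre_digraph \<Rightarrow> ('v \<Rightarrow> real) \<Rightarrow> ('e \<Rightarrow> real) \<Rightarrow> bool" where
  "sunada_sy G mV mE \<longleftrightarrow>
     (\<forall>x\<in>verts G. mE summable_on out_arcs G x) \<and>
     bdd_above ((\<lambda>x. 1 / mV x * (\<Sum>\<^sub>\<infinity>e\<in>out_arcs G x. mE e)) ` verts G)"

definition laplacian ::
    "('v, 'e) pre_digraph \<Rightarrow> ('v \<Rightarrow> real) \<Rightarrow> ('e \<Rightarrow> real) \<Rightarrow>
     ('v \<Rightarrow> complex) \<Rightarrow> 'v \<Rightarrow> complex" where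
  "laplacian G mV mE \<phi> x =
     complex_of_real (1 / mV x * (\<Sum>\<^sub>\<infinity>e\<in>out_arcs G x. mE e)) * \<phi> x
     - complex_of_real (1 / mV x) * (\<Sum>\<^sub>\<infinity>e\<in>out_arcs G x. \<phi> (head G e) * complex_of_real (mE e))"

text \<open>Under the Sunada-Sy condition, the sums in \<^const>\<open>laplacian\<close> converge on square
  summable functions.\<close>

lemma (in weighted_graph) laplacian_summable:
  assumes "sunada_sy G mV mE" "\<phi> \<in> l2_space G mV" "x \<in> verts G"
  shows "(\<lambda>e. \<phi> (head G e) * complex_of_real (mE e)) summable_on out_arcs G x"
proof -
  have sm: "mE summable_on out_arcs G y" if "y \<in> verts G" for y
    using assms(1) that by (simp add: sunada_sy_def)
  obtain C where C: "1 / mV y * (\<Sum>\<^sub>\<infinity>e\<in>out_arcs G y. mE e) \<le> C" if "y \<in> verts G" for y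
    using assms(1) by (auto simp: sunada_sy_def bdd_above_def)
  define N where "N = (\<lambda>y. (cmod (\<phi> y))\<^sup>2)"
  have Sig: "(\<lambda>(y, e). N y * mE e) summable_on Sigma (verts G) (out_arcs G)"
  proof (rule summable_on_SigmaI)
    fix y assume y: "y \<in> verts G"
    show "((\<lambda>e. case (y, e) of (y, e) \<Rightarrow> N y * mE e) has_sum
        (N y * (\<Sum>\<^sub>\<infinity>e\<in>out_arcs G y. mE e))) (out_arcs G y)"
      using has_sum_cmult_right[OF has_sum_infsum[OF sm[OF y]], of "N y"] by simp
  next
    have "(\<lambda>y. C * (N y * mV y)) summable_on verts G"
      using assms(2) by (intro summable_on_cmult_right) (simp add: l2_space_def N_def)
    then show "(\<lambda>y. N y * (\<Sum>\<^sub>\<infinity>e\<in>out_arcs G y. mE e)) summable_on verts G"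
    proof (rule summable_on_comparison_test)
      fix y assume y: "y \<in> verts G"
      have "(\<Sum>\<^sub>\<infinity>e\<in>out_arcs G y. mE e) \<le> C * mV y"
        using C[OF y] mV_pos[OF y] by (simp add: field_simps)
      then have "N y * (\<Sum>\<^sub>\<infinity>e\<in>out_arcs G y. mE e) \<le> N y * (C * mV y)"
        by (rule mult_left_mono) (simp add: N_def)
      then show "N y * (\<Sum>\<^sub>\<infinity>e\<in>out_arcs G y. mE e) \<le> C * (N y * mV y)"
        by (simp add: algebra_simps)
      show "0 \<le> N y * (\<Sum>\<^sub>\<infinity>e\<in>out_arcs G y. mE e)"
        by (intro mult_nonneg_nonneg infsum_nonneg) (auto simp: N_def intro: less_imp_le mE_pos)
    qed
  next
    fix y e assume "e \<in> out_arcs G y"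
    then show "0 \<le> (case (y, e) of (y, e) \<Rightarrow> N y * mE e)"
      using mE_pos[of e] by (simp add: N_def)
  qed
  have "bij_betw (\<lambda>e. (head G e, arev e)) (arcs G) (Sigma (verts G) (out_arcs G))"
    by (rule bij_betw_byWitness[where f' = "\<lambda>(y, e). arev e"]) auto
  from summable_on_reindex_bij_betw[OF this, of "\<lambda>(y, e). N y * mE e"] Sig
  have "(\<lambda>e. N (head G e) * mE (arev e)) summable_on arcs G"
    by simp
  then have "(\<lambda>e. N (head G e) * mE (arev e)) summable_on out_arcs G x"
    by (rule summable_on_subset) auto
  from summable_on_add[OF this sm[OF assms(3)]]
  have "(\<lambda>e. norm (\<phi> (head G e) * complex_of_real (mE e))) summable_on out_arcs G x"
  proof (rule summable_on_comparison_test)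
    fix e assume "e \<in> out_arcs G x"
    then have e: "e \<in> arcs G" by simp
    have "0 \<le> (cmod (\<phi> (head G e)) - 1)\<^sup>2"
      by simp
    then have "cmod (\<phi> (head G e)) \<le> N (head G e) + 1"
      using norm_ge_zero[of "\<phi> (head G e)"] unfolding N_def power2_diff
      by (simp del: norm_ge_zero)
    then have "cmod (\<phi> (head G e)) * mE e \<le> (N (head G e) + 1) * mE e"
      using mE_pos[OF e] by (intro mult_right_mono) auto
    then show "norm (\<phi> (head G e) * complex_of_real (mE e)) \<le> N (head G e) * mE (arev e) + mE e"
      using mE_pos[OF e] by (simp add: norm_mult mE_arev[OF e] algebra_simps)
  qed simp
  then show ?thesis
    by (rule abs_summable_summable)
qed

definition schroedinger ::
    "('v, 'e) pre_digraph \<Rightarrow> ('v \<Rightarrow> real) \<Rightarrow> ('e \<Rightarrow> real) \<Rightarrow> ('v \<Rightarrow> real) \<Rightarrow>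
     ('v \<Rightarrow> complex) \<Rightarrow> 'v \<Rightarrow> complex" where
  "schroedinger G mV mE q \<phi> x = laplacian G mV mE \<phi> x + complex_of_real (q x) * \<phi> x"

definition lambda_uniqueness ::
    "('v, 'e) pre_digraph \<Rightarrow> ('v \<Rightarrow> real) \<Rightarrow> ('e \<Rightarrow> real) \<Rightarrow> ('v \<Rightarrow> real) \<Rightarrow>
     real \<Rightarrow> 'v set \<Rightarrow> bool" where
  "lambda_uniqueness G mV mE q l \<Omega> \<longleftrightarrow>
     (\<forall>\<phi>\<in>l2_space G mV.
        (\<forall>x\<in>verts G. schroedinger G mV mE q \<phi> x = complex_of_real l * \<phi> x) \<longrightarrow>
        (\<forall>x\<in>verts G - \<Omega>. \<phi> x = 0) \<longrightarrow>
        (\<forall>x\<in>verts G. \<phi> x = 0))"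

text \<open>
  The terms of the sequence are the \<open>W n\<close> with \<open>enat n \<le> N\<close>; the sequence is infinite
  iff \<open>N = \<infinity>\<close>.
\<close>

definition one_by_one_exhaustion ::
    "('v, 'e) pre_digraph \<Rightarrow> 'v set \<Rightarrow> enat \<Rightarrow> (nat \<Rightarrow> 'v set) \<Rightarrow> bool" where
  "one_by_one_exhaustion G \<Omega> N W \<longleftrightarrow>
     (\<forall>n. enat n \<le> N \<longrightarrow> W n \<subseteq> verts G) \<and>
     (\<forall>n. enat (Suc n) \<le> N \<longrightarrow> W n \<subseteq> W (Suc n)) \<and>
     W 0 = verts G - \<Omega> \<and>
     (\<forall>n. enat (Suc n) \<le> N \<longrightarrow> (\<exists>x\<in>W n. W (Suc n) = W n \<union> graph_ball G x 1)) \<and>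
     (\<forall>n. enat (Suc n) \<le> N \<longrightarrow> card (W (Suc n) - W n) = 1 \<or> W n = verts G) \<and>
     (\<Union>n\<in>{n. enat n \<le> N}. W n) = verts G"

definition admits_one_by_one_exhaustion :: "('v, 'e) pre_digraph \<Rightarrow> 'v set \<Rightarrow> bool" where
  "admits_one_by_one_exhaustion G \<Omega> \<longleftrightarrow> (\<exists>N W. one_by_one_exhaustion G \<Omega> N W)"

end

theory Submission
  imports Defs
begin

text \<open>
  Call \<open>h\<close> the height. Every vertex \<open>v\<close> has a neighbour \<open>a\<close> one level below it, and \<open>v\<close> is the only
  neighbour of \<open>a\<close> one level above \<open>a\<close>. Since \<open>h\<close> is \<open>1\<close>-Lipschitz, all other neighbours of \<open>a\<close> lie
  strictly below \<open>v\<close>. So \<open>a\<close> ``sees'' nothing but \<open>v\<close> at or above the level of \<open>v\<close>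
  (\<open>height_graph.lower_neighbour\<close>), and both claims follow by treating the vertices of \<open>\<Omega>\<close> from the
  lowest level upwards.

  If \<open>\<Omega>\<close> is finite and \<open>v \<in> \<Omega>\<close> has minimal height, then \<open>a\<close> and all its neighbours other than \<open>v\<close>
  lie outside \<open>\<Omega>\<close>. Adjoining the ball of radius \<open>1\<close> around \<open>a\<close> to the complement of \<open>\<Omega>\<close>
  therefore adds \<open>v\<close> alone, and one continues with \<open>\<Omega> - {v}\<close>.

  For uniqueness, \<open>\<Omega>\<close> may contain infinitely many vertices of each level, and even of the lowest one,
  so it need not be possible to enumerate them level by level in one sequence; but whole levels can be
  treated at once. If a solution \<open>\<phi>\<close> of the eigenvalue equation vanishes strictly below the level of
  \<open>v\<close>, the equation at \<open>a\<close> says that \<open>\<phi> v\<close> times the total weight of the edges from \<open>a\<close> to \<open>v\<close> is zero.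
  That weight is positive, so \<open>\<phi> v = 0\<close>. The induction on the level starts because \<open>h\<close> is bounded
  below on \<open>\<Omega>\<close> and \<open>\<phi>\<close> vanishes elsewhere.
\<close>

section \<open>Vertices at distance at most one\<close>

lemma (in wf_digraph) path_dist_head_le_1:
  assumes "e \<in> arcs G"
  shows "path_dist G (tail G e) (head G e) \<le> 1"
  unfolding path_dist_def using assms by (intro Least_le) (auto intro!: exI[of _ "[e]"] arc_implies_awalk)

lemma (in wf_digraph) path_dist_attained:
  assumes "awalk x p y"
  obtains p' where "awalk x p' y" "length p' = path_dist G x y"
proof -
  have "\<exists>p'. awalk x p' y \<and> length p' = path_dist G x y"
    unfolding path_dist_def by (rule LeastI_ex) (use assms in auto)
  then show thesis
    using that by auto
qed

lemma (in wf_digraph) path_dist_le_1_iff: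
  assumes "awalk x p y"
  shows "path_dist G x y \<le> 1 \<longleftrightarrow> x = y \<or> (\<exists>e\<in>out_arcs G x. head G e = y)"
proof
  assume le: "path_dist G x y \<le> 1"
  obtain p' where p': "awalk x p' y" "length p' = path_dist G x y"
    using path_dist_attained[OF assms] .
  then have "p' = [] \<or> (\<exists>e. p' = [e])"
    using le by (auto simp: le_Suc_eq length_Suc_conv)
  then show "x = y \<or> (\<exists>e\<in>out_arcs G x. head G e = y)"
    using p'(1) by (auto simp: awalk_def)
next
  assume "x = y \<or> (\<exists>e\<in>out_arcs G x. head G e = y)"
  moreover have "path_dist G x x \<le> 1"
    using assms unfolding path_dist_def
    by (intro order_trans[OF Least_le[of _ 0]]) (auto simp: awalk_Nil_iff)
  ultimately show "path_dist G x y \<le> 1"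
  proof (elim disjE)
    assume "\<exists>e\<in>out_arcs G x. head G e = y"
    then obtain e where "e \<in> arcs G" "tail G e = x" "head G e = y"
      by auto
    then show ?thesis
      using path_dist_head_le_1 by blast
  qed simp
qed

section \<open>One-by-one exhaustions\<close>

text \<open>An exhaustion of \<open>\<Omega>\<close> starts with the complement of \<open>\<Omega>\<close>, so it can follow any admissible step
  that adjoins \<open>v\<close> to the complement of \<open>insert v \<Omega>\<close>. This turns the construction of exhaustions
  of finite sets into an induction on the set.\<close>

lemma admits_one_by_one_exhaustion_insert:
  assumes exh: "admits_one_by_one_exhaustion G \<Omega>"
    and v: "v \<in> verts G" "v \<notin> \<Omega>"
    and x: "x \<in> verts G" "x \<notin> insert v \<Omega>"
    and ball: "v \<in> graph_ball G x 1" "graph_ball G x 1 \<inter> \<Omega> = {}"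
  shows "admits_one_by_one_exhaustion G (insert v \<Omega>)"
proof -
  obtain N W where W: "one_by_one_exhaustion G \<Omega> N W"
    using exh by (auto simp: admits_one_by_one_exhaustion_def)
  define W' where "W' = case_nat (verts G - insert v \<Omega>) W"
  have W'_simps: "W' 0 = verts G - insert v \<Omega>" "W' (Suc n) = W n" for n
    by (simp_all add: W'_def)
  have W0: "W 0 = verts G - \<Omega>"
    using W by (simp add: one_by_one_exhaustion_def)
  have Suc_le: "enat (Suc n) \<le> eSuc N \<longleftrightarrow> enat n \<le> N" for n
    by (simp flip: eSuc_enat)
  have "graph_ball G x 1 \<subseteq> verts G"
    by (auto simp: graph_ball_def)
  then have first: "W 0 = (verts G - insert v \<Omega>) \<union> graph_ball G x 1"
    using v ball unfolding W0 by (intro equalityI subsetI) auto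
  have single: "W 0 - (verts G - insert v \<Omega>) = {v}"
    using v unfolding W0 by auto
  have "one_by_one_exhaustion G (insert v \<Omega>) (eSuc N) W'"
    unfolding one_by_one_exhaustion_def
  proof (intro conjI allI impI)
    show "W' 0 = verts G - insert v \<Omega>"
      by (simp add: W'_simps)
  next
    fix n assume n: "enat n \<le> eSuc N"
    show "W' n \<subseteq> verts G"
      using W n by (cases n) (auto simp: W'_simps Suc_le one_by_one_exhaustion_def)
  next
    fix n assume n: "enat (Suc n) \<le> eSuc N"
    show "W' n \<subseteq> W' (Suc n)"
      using W n W0 by (cases n) (auto simp: W'_simps Suc_le one_by_one_exhaustion_def)
  next
    fix n assume n: "enat (Suc n) \<le> eSuc N"
    show "\<exists>x\<in>W' n. W' (Suc n) = W' n \<union> graph_ball G x 1"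
    proof (cases n)
      case 0
      then show ?thesis
        using first x by (auto simp: W'_simps)
    next
      case (Suc m)
      then show ?thesis
        using W n by (simp add: W'_simps Suc_le one_by_one_exhaustion_def)
    qed
  next
    fix n assume n: "enat (Suc n) \<le> eSuc N"
    show "card (W' (Suc n) - W' n) = 1 \<or> W' n = verts G"
    proof (cases n)
      case 0
      then show ?thesis
        using single by (simp add: W'_simps)
    next
      case (Suc m)
      then show ?thesis
        using W n by (simp add: W'_simps Suc_le one_by_one_exhaustion_def)
    qed
  next
    have "{n. enat n \<le> eSuc N} = insert 0 (Suc ` {n. enat n \<le> N})"
    proof (rule set_eqI)
      fix n show "n \<in> {n. enat n \<le> eSuc N} \<longleftrightarrow> n \<in> insert 0 (Suc ` {n. enat n \<le> N})"
        by (cases n) (auto simp: Suc_le zero_enat_def[symmetric])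
    qed
    then have "(\<Union>n\<in>{n. enat n \<le> eSuc N}. W' n) =
        (verts G - insert v \<Omega>) \<union> (\<Union>n\<in>{n. enat n \<le> N}. W n)"
      by (simp add: W'_simps)
    then show "(\<Union>n\<in>{n. enat n \<le> eSuc N}. W' n) = verts G"
      using W by (auto simp: one_by_one_exhaustion_def)
  qed
  then show ?thesis
    by (auto simp: admits_one_by_one_exhaustion_def)
qed

lemma admits_one_by_one_exhaustion_empty: "admits_one_by_one_exhaustion G {}"
proof -
  have "one_by_one_exhaustion G {} 0 (\<lambda>_. verts G)"
    by (auto simp: one_by_one_exhaustion_def zero_enat_def)
  then show ?thesis
    by (auto simp: admits_one_by_one_exhaustion_def)
qed

section \<open>Graphs with a height function\<close>

locale height_graph = wf_digraph G for G :: "('v, 'e) pre_digraph" +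
  fixes h :: "'v \<Rightarrow> int"
  assumes connected: "graph_connected G"
    and height_lipschitz:
      "\<lbrakk>x \<in> verts G; y \<in> verts G\<rbrakk> \<Longrightarrow> \<bar>h x - h y\<bar> \<le> int (path_dist G x y)"
    and unique_above:
      "b \<in> verts G \<Longrightarrow> \<exists>!c. c \<in> verts G \<and> path_dist G b c = 1 \<and> h c = h b + 1"
    and exists_below:
      "b \<in> verts G \<Longrightarrow> \<exists>a\<in>verts G. path_dist G a b = 1 \<and> h a = h b - 1"
begin

lemma graph_ball_1:
  assumes "x \<in> verts G"
  shows "graph_ball G x 1 = insert x (head G ` out_arcs G x)"
proof (rule set_eqI)
  fix y
  show "y \<in> graph_ball G x 1 \<longleftrightarrow> y \<in> insert x (head G ` out_arcs G x)"
  proof (cases "y \<in> verts G")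
    case True
    then obtain p where "awalk x p y"
      using connected assms by (auto simp: graph_connected_def)
    from path_dist_le_1_iff[OF this] True show ?thesis
      by (auto simp: graph_ball_def)
  next
    case False
    with assms show ?thesis
      by (auto simp: graph_ball_def)
  qed
qed

text \<open>The neighbour \<open>a\<close> below \<open>v\<close> is the vertex at which a ball of radius \<open>1\<close>, or an equation
  that involves only neighbours, isolates \<open>v\<close> from everything else at its level or above.\<close>

lemma lower_neighbour:
  assumes v: "v \<in> verts G"
  obtains a where "a \<in> verts G" "h a < h v" "v \<in> head G ` out_arcs G a"
    "\<And>y. y \<in> head G ` out_arcs G a \<Longrightarrow> y \<noteq> v \<Longrightarrow> h y < h v"
proof -
  obtain a where a: "a \<in> verts G" "path_dist G a v = 1" "h a = h v - 1"
    using exists_below[OF v] by blast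
  have "v \<in> graph_ball G a 1"
    using a v by (simp add: graph_ball_def)
  then have "v \<in> head G ` out_arcs G a"
    using a unfolding graph_ball_1[OF a(1)] by auto
  moreover have "h y < h v" if y: "y \<in> head G ` out_arcs G a" "y \<noteq> v" for y
  proof (rule ccontr)
    assume "\<not> h y < h v"
    have "y \<in> graph_ball G a 1"
      using y unfolding graph_ball_1[OF a(1)] by simp
    then have y': "y \<in> verts G" "path_dist G a y \<le> 1"
      by (auto simp: graph_ball_def)
    \<comment> \<open>A height difference of at least \<open>1\<close> forces distance and height difference to be exactly \<open>1\<close>,
      so that \<open>y\<close> would be a second vertex above \<open>a\<close>.\<close>
    then have "path_dist G a y = 1 \<and> h y = h a + 1"
      using height_lipschitz[OF a(1) y'(1)] a(3) \<open>\<not> h y < h v\<close> by linarith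
    with unique_above[OF a(1)] a v y y' show False
      by auto
  qed
  ultimately show thesis
    using that[of a] a by simp
qed

lemma finite_admits_one_by_one_exhaustion:
  assumes "finite \<Omega>" "\<Omega> \<subseteq> verts G"
  shows "admits_one_by_one_exhaustion G \<Omega>"
  using assms
  \<comment> \<open>Induction on \<open>\<Omega>\<close> by adding a vertex of minimal height, i.e. of maximal \<open>- h\<close>.\<close>
proof (induction \<Omega> rule: finite_ranking_induct[where f = "\<lambda>v. - h v"])
  case empty
  show ?case by (rule admits_one_by_one_exhaustion_empty)
next
  case (insert v \<Omega>)
  show ?case
  proof (cases "v \<in> \<Omega>")
    case True
    then show ?thesis
      using insert by (simp add: insert_absorb)
  next
    case False
    obtain a where a: "a \<in> verts G" "h a < h v" "v \<in> head G ` out_arcs G a"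
      and below: "\<And>y. y \<in> head G ` out_arcs G a \<Longrightarrow> y \<noteq> v \<Longrightarrow> h y < h v"
      using lower_neighbour insert.prems by blast
    have not_below: "y \<notin> insert v \<Omega>" if "h y < h v" for y
      using insert.hyps(2) that by force
    have ball: "graph_ball G a 1 = insert a (head G ` out_arcs G a)"
      using a(1) by (rule graph_ball_1)
    have "y \<notin> \<Omega>" if "y \<in> graph_ball G a 1" for y
      using that False a(2) below[of y] not_below[of y] unfolding ball by (cases "y = v") auto
    then have disjoint: "graph_ball G a 1 \<inter> \<Omega> = {}"
      by (simp add: disjoint_iff)
    show ?thesis
    proof (rule admits_one_by_one_exhaustion_insert)
      show "admits_one_by_one_exhaustion G \<Omega>" "v \<in> verts G"
        using insert by simp_all
      show "v \<in> graph_ball G a 1"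
        unfolding ball using a(3) by simp
    qed (use False a(1) not_below[OF a(2)] disjoint in simp_all)
  qed
qed

section \<open>Unique continuation from below\<close>

text \<open>The equation is used only at the lower neighbour \<open>a\<close> of \<open>v\<close>. There \<open>\<phi>\<close> vanishes at \<open>a\<close> and at
  all neighbours of \<open>a\<close> other than \<open>v\<close>, so that \<open>\<phi> v\<close> factors out of the possibly infinite sum
  in the Laplacian.\<close>

lemma schroedinger_unique_continuation:
  assumes mV: "\<And>x. x \<in> verts G \<Longrightarrow> mV x > 0"
    and mE: "\<And>e. e \<in> arcs G \<Longrightarrow> mE e > 0"
    and summable: "\<And>x. x \<in> verts G \<Longrightarrow> mE summable_on out_arcs G x"
    and eigen: "\<And>x. x \<in> verts G \<Longrightarrow> schroedinger G mV mE q \<phi> x = z * \<phi> x"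
    and v: "v \<in> verts G"
    and zero_below: "\<And>y. y \<in> verts G \<Longrightarrow> h y < h v \<Longrightarrow> \<phi> y = 0"
  shows "\<phi> v = 0"
proof -
  obtain a where a: "a \<in> verts G" "h a < h v" "v \<in> head G ` out_arcs G a"
    and below: "\<And>y. y \<in> head G ` out_arcs G a \<Longrightarrow> y \<noteq> v \<Longrightarrow> h y < h v"
    using lower_neighbour[OF v] by blast
  define F where "F = {e \<in> out_arcs G a. head G e = v}"
  define w where "w = (\<Sum>\<^sub>\<infinity>e\<in>F. mE e)"
  obtain e where e: "e \<in> F"
    using a(3) by (auto simp: F_def)
  have sumF: "mE summable_on F"
    by (rule summable_on_subset_banach[OF summable[OF a(1)]]) (auto simp: F_def)
  have "sum mE {e} \<le> w"
    unfolding w_def using e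
    by (intro finite_sum_le_infsum[OF sumF]) (auto simp: F_def intro: less_imp_le[OF mE])
  moreover have "mE e > 0"
    using e by (intro mE) (auto simp: F_def)
  ultimately have w: "w > 0"
    by simp
  have "(\<Sum>\<^sub>\<infinity>e\<in>out_arcs G a. \<phi> (head G e) * complex_of_real (mE e)) =
      (\<Sum>\<^sub>\<infinity>e\<in>F. \<phi> v * complex_of_real (mE e))"
    by (rule infsum_cong_neutral) (use below zero_below in \<open>auto simp: F_def\<close>)
  also have "\<dots> = \<phi> v * complex_of_real w"
    unfolding w_def
    by (intro infsumI has_sum_cmult_right has_sum_of_real has_sum_infsum sumF)
  finally have "schroedinger G mV mE q \<phi> a =
      - (complex_of_real (1 / mV a) * (\<phi> v * complex_of_real w))"
    using zero_below[OF a(1,2)] by (simp add: schroedinger_def laplacian_def)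
  then show ?thesis
    using eigen[OF a(1)] zero_below[OF a(1,2)] mV[OF a(1)] w by simp
qed

lemma lambda_uniqueness_bounded_below:
  assumes "weighted_graph G arev mV mE" "sunada_sy G mV mE" "bdd_below (h ` \<Omega>)"
  shows "lambda_uniqueness G mV mE q l \<Omega>"
  unfolding lambda_uniqueness_def
proof (intro ballI impI)
  interpret weighted_graph G arev mV mE by fact
  fix \<phi> v
  assume eigen: "\<forall>x\<in>verts G. schroedinger G mV mE q \<phi> x = complex_of_real l * \<phi> x"
    and outside: "\<forall>x\<in>verts G - \<Omega>. \<phi> x = 0"
    and v: "v \<in> verts G"
  obtain m where m: "\<And>x. x \<in> \<Omega> \<Longrightarrow> m \<le> h x"
    using assms(3) by (auto simp: bdd_below_def)
  \<comment> \<open>The shift by \<open>1\<close> makes the measure drop from level \<open>m\<close> to the levels below it.\<close>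
  show "\<phi> v = 0"
    using v
  proof (induction "nat (h v + 1 - m)" arbitrary: v rule: less_induct)
    case less
    show ?case
    proof (cases "h v < m")
      case True
      then show ?thesis
        using m outside less.prems by force
    next
      case False
      show ?thesis
      proof (rule schroedinger_unique_continuation[of mV mE q \<phi> "complex_of_real l"])
        show "\<phi> y = 0" if "y \<in> verts G" "h y < h v" for y
          using less.hyps[of y] that False by simp
        show "mE summable_on out_arcs G x" if "x \<in> verts G" for x
          using assms(2) that by (simp add: sunada_sy_def)
      qed (use eigen less.prems mV_pos mE_pos in auto)
    qed
  qed
qed

end

section \<open>Exhaustion and uniqueness\<close>

theorem theorem3p8:
  fixes G :: "('v, 'e) pre_digraph" and arev :: "'e \<Rightarrow> 'e" and h :: "'v \<Rightarrow> int"
  assumes "bidirected_digraph G arev"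
    and "graph_connected G"
    and A: "\<forall>x\<in>verts G. \<forall>y\<in>verts G. \<bar>h x - h y\<bar> \<le> int (path_dist G x y)"
    and B: "\<forall>b\<in>verts G. \<exists>!c. c \<in> verts G \<and> path_dist G b c = 1 \<and> h c = h b + 1"
    and C: "\<forall>b\<in>verts G. \<exists>a\<in>verts G. path_dist G a b = 1 \<and> h a = h b - 1"
  shows "(\<forall>\<Omega>\<subseteq>verts G. finite \<Omega> \<longrightarrow> admits_one_by_one_exhaustion G \<Omega>) \<and>
    (\<forall>mV mE q l \<Omega>.
       weighted_graph G arev mV mE \<longrightarrow> sunada_sy G mV mE \<longrightarrow> bounded (q ` verts G) \<longrightarrow>
       \<Omega> \<subseteq> verts G \<longrightarrow> bdd_below (h ` \<Omega>) \<longrightarrow>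
       lambda_uniqueness G mV mE q l \<Omega>)"
proof -
  interpret bidirected_digraph G arev by fact
  interpret height_graph G h
    by unfold_locales (use assms(2) A B C in auto)
  show ?thesis
    by (intro conjI allI impI finite_admits_one_by_one_exhaustion lambda_uniqueness_bounded_below)
qed

end
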